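(* For every integer $n\ge 0$, there are at least $2^n$ distinct $(n+2)$-planar-feasible vectors.
   Context: $\tau(G)$ is the number of spanning trees of a (multi)graph $G$ (parallel edges counted as distinct). For an edge $e$ of $G$, $G/e$ is the multigraph obtained by contracting $e$ and $G-e$ the graph obtained by deleting $e$. A vector $(t,u)^T$ of integers is $n$-planar-feasible if there exist a simple planar graph $G$ on at most $n$ vertices and an edge $e\in E(G)$ with $t=\tau(G/e)$ and $u=\tau(G-e)$. *)

theory Defs
  imports "HOL-Analysis.Path_Connected"
begin

text \<open>
  Undirected multigraphs: every edge has an identity of its own and a set of one (loop) or
  two ends, so parallel edges are distinct edges.
\<close>

record ('v, 'e) multigraph =
  verts :: "'v set"
  edges :: "'e set"
  ends :: "'e \<Rightarrow> 'v set"

definition finite_multigraph :: "('v, 'e) multigraph \<Rightarrow> bool" where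
  "finite_multigraph G \<longleftrightarrow>
     finite (verts G) \<and> finite (edges G) \<and>
     (\<forall>e\<in>edges G. ends G e \<subseteq> verts G \<and> card (ends G e) \<in> {1, 2})"

definition simple_multigraph :: "('v, 'e) multigraph \<Rightarrow> bool" where
  "simple_multigraph G \<longleftrightarrow>
     (\<forall>e\<in>edges G. card (ends G e) = 2) \<and> inj_on (ends G) (edges G)"

definition adjacency :: "('v, 'e) multigraph \<Rightarrow> ('v \<times> 'v) set" where
  "adjacency G = {(x, y). \<exists>e\<in>edges G. ends G e = {x, y}}"

definition connected_multigraph :: "('v, 'e) multigraph \<Rightarrow> bool" where
  "connected_multigraph G \<longleftrightarrow>
     verts G \<noteq> {} \<and> (\<forall>x\<in>verts G. \<forall>y\<in>verts G. (x, y) \<in> (adjacency G)\<^sup>*)"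

text \<open>
  The cycle \<open>xs ! 0, es ! 0, xs ! 1, es ! 1, \<dots>\<close> returning to \<open>xs ! 0\<close>.  A loop is a cycle of
  length 1, a pair of parallel edges gives a cycle of length 2.
\<close>

definition is_cycle :: "('v, 'e) multigraph \<Rightarrow> 'v list \<Rightarrow> 'e list \<Rightarrow> bool" where
  "is_cycle G xs es \<longleftrightarrow>
     es \<noteq> [] \<and> length xs = length es \<and> distinct xs \<and> distinct es \<and> set es \<subseteq> edges G \<and>
     (\<forall>i<length es. ends G (es ! i) = {xs ! i, xs ! (Suc i mod length es)})"

definition is_tree :: "('v, 'e) multigraph \<Rightarrow> bool" where
  "is_tree G \<longleftrightarrow> connected_multigraph G \<and> (\<nexists>xs es. is_cycle G xs es)"

definition spanning_trees :: "('v, 'e) multigraph \<Rightarrow> 'e set set" where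
  "spanning_trees G = {T. T \<subseteq> edges G \<and> is_tree (G\<lparr>edges := T\<rparr>)}"

definition tau :: "('v, 'e) multigraph \<Rightarrow> nat" where
  "tau G = card (spanning_trees G)"

definition delete_edge :: "('v, 'e) multigraph \<Rightarrow> 'e \<Rightarrow> ('v, 'e) multigraph" where
  "delete_edge G e = G\<lparr>edges := edges G - {e}\<rparr>"

text \<open>
  Contraction as a quotient: the vertices of \<open>G / e\<close> are the classes of the partition of the
  vertex set whose only possibly non-singleton block consists of the ends of \<open>e\<close>.
\<close>

definition contract_vertex :: "('v, 'e) multigraph \<Rightarrow> 'e \<Rightarrow> 'v \<Rightarrow> 'v set" where
  "contract_vertex G e v = (if v \<in> ends G e then ends G e else {v})"

definition contract_edge :: "('v, 'e) multigraph \<Rightarrow> 'e \<Rightarrow> ('v set, 'e) multigraph" where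
  "contract_edge G e =
     \<lparr>verts = contract_vertex G e ` verts G,
      edges = edges G - {e},
      ends = (\<lambda>f. contract_vertex G e ` ends G f)\<rparr>"

text \<open>
  A drawing in the plane: an edge is drawn as a simple path joining its ends (an arc, or a
  simple closed curve for a loop) whose relative interior contains no vertex and no point of
  any other edge.
\<close>

definition plane_drawing ::
    "('v, 'e) multigraph \<Rightarrow> ('v \<Rightarrow> complex) \<Rightarrow> ('e \<Rightarrow> real \<Rightarrow> complex) \<Rightarrow> bool" where
  "plane_drawing G p \<gamma> \<longleftrightarrow>
     inj_on p (verts G) \<and>
     (\<forall>e\<in>edges G.
        simple_path (\<gamma> e) \<and>
        {pathstart (\<gamma> e), pathfinish (\<gamma> e)} = p ` ends G e \<and>
        (path_image (\<gamma> e) - p ` ends G e) \<inter> p ` verts G = {} \<and>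
        (\<forall>f\<in>edges G. f \<noteq> e \<longrightarrow> (path_image (\<gamma> e) - p ` ends G e) \<inter> path_image (\<gamma> f) = {}))"

definition planar_multigraph :: "('v, 'e) multigraph \<Rightarrow> bool" where
  "planar_multigraph G \<longleftrightarrow> (\<exists>p \<gamma>. plane_drawing G p \<gamma>)"

text \<open>
  Every finite multigraph is isomorphic to one with vertices and edges of type \<open>nat\<close>.
\<close>

definition planar_feasible :: "nat \<Rightarrow> int \<times> int \<Rightarrow> bool" where
  "planar_feasible n v \<longleftrightarrow>
     (\<exists>(G :: (nat, nat) multigraph) e.
        finite_multigraph G \<and> simple_multigraph G \<and> planar_multigraph G \<and>
        card (verts G) \<le> n \<and> e \<in> edges G \<and>
        v = (int (tau (contract_edge G e)), int (tau (delete_edge G e))))"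

end

theory Submission
  imports Defs
begin

text \<open>
  Take a path with end \<open>y\<close>, a hub \<open>x\<close> joined to some of the other path vertices, and the spoke
  \<open>e = xy\<close>; such a graph is planar.  Let \<open>(t, u)\<close> be its vector.  Prolong the path by a new
  vertex \<open>w\<close> and use the spoke \<open>xw\<close> as the new distinguished edge.  Since \<open>w\<close> has degree two, a
  spanning tree either has \<open>w\<close> as a leaf or arises by subdividing \<open>e\<close>, so the new vector is
  \<open>(t + u, u)\<close> if \<open>e\<close> is dropped and \<open>(2 * t + u, t + u)\<close> if \<open>e\<close> is kept.  Starting from the
  vector \<open>(1, 0)\<close> of a single edge, all vectors satisfy \<open>0 \<le> u < t\<close>; on these the two maps
  are injective with disjoint images, so each new vertex doubles the number of vectors.
\<close>

section \<open>Trees as connected graphs in which every edge is a bridge\<close>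

text \<open>It takes an edge set rather than a multigraph, so that single edges can be inserted or
  removed freely. It is reflexive at every element of the vertex type, so no vertex set
  appears.\<close>

definition links :: "('e \<Rightarrow> 'v set) \<Rightarrow> 'e set \<Rightarrow> ('v \<times> 'v) set" where
  "links en T = {(x, y). \<exists>e\<in>T. en e = {x, y}}\<^sup>*"

text \<open>The bridge condition replaces the absence of cycles, since it can be followed through
  edge insertions without handling lists. A loop violates it, by reflexivity of
  \<open>links\<close>.\<close>

definition tree_on :: "'v set \<Rightarrow> ('e \<Rightarrow> 'v set) \<Rightarrow> 'e set \<Rightarrow> bool" where
  "tree_on V en T \<longleftrightarrow>
     V \<noteq> {} \<and> (\<forall>x\<in>V. \<forall>y\<in>V. (x, y) \<in> links en T) \<and>
     (\<forall>f\<in>T. \<forall>a b. en f = {a, b} \<longrightarrow> (a, b) \<notin> links en (T - {f}))"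

lemma links_refl [simp]: "(x, x) \<in> links en T"
  by (simp add: links_def)

lemma links_edge: "f \<in> T \<Longrightarrow> en f = {a, b} \<Longrightarrow> (a, b) \<in> links en T"
  unfolding links_def by (rule r_into_rtrancl) auto

lemma links_trans: "(x, y) \<in> links en T \<Longrightarrow> (y, z) \<in> links en T \<Longrightarrow> (x, z) \<in> links en T"
  unfolding links_def by (rule rtrancl_trans)

lemma links_sym: "(x, y) \<in> links en T \<Longrightarrow> (y, x) \<in> links en T"
proof -
  have "sym {(x, y). \<exists>e\<in>T. en e = {x, y}}"
    by (auto simp: sym_def insert_commute)
  then show "(x, y) \<in> links en T \<Longrightarrow> (y, x) \<in> links en T"
    unfolding links_def by (rule symD[OF sym_rtrancl])
qed

lemma links_mono:
  assumes "(x, y) \<in> links en T" "T \<subseteq> U"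
  shows "(x, y) \<in> links en U"
proof -
  have "{(x, y). \<exists>e\<in>T. en e = {x, y}} \<subseteq> {(x, y). \<exists>e\<in>U. en e = {x, y}}"
    using assms(2) by auto
  from rtrancl_mono[OF this] show ?thesis using assms(1) unfolding links_def by blast
qed

lemma links_induct [consumes 1, case_names refl step]:
  assumes "(x, y) \<in> links en T" "P x"
    "\<And>y z f. (x, y) \<in> links en T \<Longrightarrow> f \<in> T \<Longrightarrow> en f = {y, z} \<Longrightarrow> P y \<Longrightarrow> P z"
  shows "P y"
  using assms(1) unfolding links_def
proof (induction rule: rtrancl_induct)
  case base
  show ?case by (rule assms(2))
next
  case (step y z)
  then show ?case using assms(3)[of y] unfolding links_def by auto
qed

text \<open>A walk never has to cross \<open>f\<close> more than once, and it may do so in either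
  direction. This is the rewriting rule behind all later comparisons of connectivity.\<close>

lemma links_insert:
  assumes "en f = {a, b}"
  shows "(x, y) \<in> links en (insert f T) \<longleftrightarrow>
    (x, y) \<in> links en T \<or>
    (x, a) \<in> links en T \<and> (b, y) \<in> links en T \<or>
    (x, b) \<in> links en T \<and> (a, y) \<in> links en T"
    (is "_ \<longleftrightarrow> ?R y")
proof
  assume "(x, y) \<in> links en (insert f T)"
  then show "?R y"
  proof (induction rule: links_induct)
    case refl
    show ?case by simp
  next
    case (step y z g)
    show ?case
    proof (cases "g \<in> T")
      case True
      then have "(y, z) \<in> links en T" using step by (blast intro: links_edge)
      then show ?thesis using step.IH links_trans by fast
    next
      case False
      then have "{y, z} = {a, b}" using step assms by auto
      then have "y = a \<and> z = b \<or> y = b \<and> z = a" by (auto simp: doubleton_eq_iff)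
      \<comment> \<open>In each case of the induction hypothesis \<open>x\<close> is linked within
        \<open>T\<close> to an end of \<open>f\<close>, and \<open>z\<close> is either that end or
        the opposite one. So one crossing still suffices.\<close>
      then show ?thesis using step.IH links_refl links_trans links_sym by metis
    qed
  qed
next
  have *: "(u, v) \<in> links en (insert f T)" if "(u, v) \<in> links en T" for u v
    using that by (rule links_mono) auto
  have "(a, b) \<in> links en (insert f T)" using assms by (auto intro: links_edge)
  moreover assume "?R y"
  ultimately show "(x, y) \<in> links en (insert f T)"
    using * links_trans links_sym by metis
qed

lemma links_isolated:
  assumes "\<And>f. f \<in> T \<Longrightarrow> w \<notin> en f"
  shows "(w, z) \<in> links en T \<longleftrightarrow> z = w" "(z, w) \<in> links en T \<longleftrightarrow> z = w"
proof -
  have *: "z = w" if "(w, z) \<in> links en T" for z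
    using that by (induction rule: links_induct) (use assms in auto)
  show "(w, z) \<in> links en T \<longleftrightarrow> z = w" using * by auto
  show "(z, w) \<in> links en T \<longleftrightarrow> z = w" using * links_sym by fastforce
qed

text \<open>The rest of the cycle bypasses its closing edge.\<close>

lemma is_cycle_non_bridge:
  assumes "is_cycle G xs es"
  shows "\<exists>f\<in>edges G. \<exists>a b. ends G f = {a, b} \<and> (a, b) \<in> links (ends G) (edges G - {f})"
proof -
  \<comment> \<open>\<open>es ! m\<close> is the closing edge: there the index
    \<open>Suc m mod Suc m\<close> wraps around to 0.\<close>
  define m where "m = length es - 1"
  have len: "length es = Suc m" "length xs = Suc m"
    using assms by (auto simp: is_cycle_def m_def)
  have dist: "distinct es" and sub: "set es \<subseteq> edges G"
    and en: "\<And>i. i < Suc m \<Longrightarrow> ends G (es ! i) = {xs ! i, xs ! (Suc i mod Suc m)}"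
    using assms len by (auto simp: is_cycle_def)
  have "(xs ! 0, xs ! i) \<in> links (ends G) (edges G - {es ! m})" if "i \<le> m" for i
    using that
  proof (induction i)
    case 0
    show ?case by simp
  next
    case (Suc i)
    have "es ! i \<in> edges G - {es ! m}"
      using Suc.prems dist sub len by (auto simp: nth_eq_iff_index_eq)
    moreover have "ends G (es ! i) = {xs ! i, xs ! Suc i}"
      using en[of i] Suc.prems by simp
    ultimately show ?case using Suc links_edge links_trans by (metis Suc_leD)
  qed
  from this[of m] have "(xs ! m, xs ! 0) \<in> links (ends G) (edges G - {es ! m})"
    by (simp add: links_sym)
  moreover have "ends G (es ! m) = {xs ! m, xs ! 0}" using en[of m] by simp
  moreover have "es ! m \<in> edges G" using sub len by auto
  ultimately show ?thesis by blast
qed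

text \<open>A shortest walk from \<open>a\<close> to \<open>b\<close> avoiding \<open>f\<close>
  repeats no vertex, so \<open>f\<close> closes it to a cycle.\<close>

lemma non_bridge_is_cycle:
  assumes f: "f \<in> edges G" "ends G f = {a, b}"
    and ab: "(a, b) \<in> links (ends G) (edges G - {f})"
  shows "\<exists>xs es. is_cycle G xs es"
proof -
  define R where "R = {(x, y). \<exists>e\<in>edges G - {f}. ends G e = {x, y}}"
  define n where "n = (LEAST n. (a, b) \<in> R ^^ n)"
  have ex: "\<exists>n. (a, b) \<in> R ^^ n"
    using ab unfolding links_def R_def by (simp add: rtrancl_power)
  have n: "(a, b) \<in> R ^^ n" unfolding n_def by (rule LeastI_ex[OF ex])
  have least: "n \<le> m" if "(a, b) \<in> R ^^ m" for m
    unfolding n_def using that by (rule Least_le)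
  obtain p where p: "p 0 = a" "p n = b" "\<And>i. i < n \<Longrightarrow> (p i, p (Suc i)) \<in> R"
    using n by (auto simp: relpow_fun_conv)
  have seg: "(p i, p (i + k)) \<in> R ^^ k" if "i + k \<le> n" for i k
    using that
  proof (induction k)
    case (Suc k)
    then show ?case using p(3)[of "i + k"] by auto
  qed auto
  \<comment> \<open>A repeated vertex would allow the stretch from \<open>i\<close> to
    \<open>j\<close> to be cut out, against the minimality of \<open>n\<close>.\<close>
  have neq: "p i \<noteq> p j" if "i < j" "j \<le> n" for i j
  proof
    assume eq: "p i = p j"
    have "(a, p j) \<in> R ^^ i" using seg[of 0 i] that p(1) eq by simp
    moreover have "(p j, b) \<in> R ^^ (n - j)" using seg[of j "n - j"] that p(2) by simp
    ultimately have "(a, b) \<in> R ^^ (i + (n - j))" by (auto simp: relpow_add)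
    from least[OF this] show False using that by simp
  qed
  then have inj: "p i = p j \<longleftrightarrow> i = j" if "i \<le> n" "j \<le> n" for i j
    using that by (metis nat_neq_iff)
  have "\<forall>i. \<exists>e. i < n \<longrightarrow> e \<in> edges G - {f} \<and> ends G e = {p i, p (Suc i)}"
    using p(3) by (auto simp: R_def)
  then obtain g where g: "\<And>i. i < n \<Longrightarrow> g i \<in> edges G - {f} \<and> ends G (g i) = {p i, p (Suc i)}"
    by metis
  define xs where "xs = map p [0..<Suc n]"
  \<comment> \<open>\<open>f\<close> leads from \<open>b\<close> back to \<open>a\<close>. If
    \<open>f\<close> is a loop, then \<open>n = 0\<close> and the cycle is \<open>f\<close>
    alone.\<close>
  define es where "es = map g [0..<n] @ [f]"
  have "inj_on g {0..<n}"
  proof (rule inj_onI)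
    fix i j assume ij: "i \<in> {0..<n}" "j \<in> {0..<n}" "g i = g j"
    then have "{p i, p (Suc i)} = {p j, p (Suc j)}" using g[of i] g[of j] by auto
    then show "i = j" using ij by (auto simp: doubleton_eq_iff inj)
  qed
  moreover have "f \<notin> g ` {0..<n}" using g by fastforce
  ultimately have "distinct es" by (simp add: es_def distinct_map)
  moreover have "distinct xs"
    using inj by (auto simp: xs_def distinct_map inj_on_def simp del: upt_Suc)
  moreover have "ends G (es ! i) = {xs ! i, xs ! (Suc i mod length es)}" if "i < length es" for i
  proof (cases "i < n")
    case True
    then have "xs ! i = p i" "xs ! Suc i = p (Suc i)" "es ! i = g i" "length es = Suc n"
      by (auto simp: xs_def es_def nth_append simp del: upt_Suc)
    then show ?thesis using g[of i] True by simp
  next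
    case False
    then have "i = n" using that by (simp add: es_def)
    moreover have "xs ! n = p n" "xs ! 0 = p 0" "es ! n = f" "length es = Suc n"
      by (auto simp: xs_def es_def nth_append simp del: upt_Suc)
    ultimately show ?thesis using p f by auto
  qed
  moreover have "set es \<subseteq> edges G" using g f by (auto simp: es_def)
  ultimately have "is_cycle G xs es"
    by (auto simp: is_cycle_def xs_def es_def)
  then show ?thesis by blast
qed

lemma is_tree_iff: "is_tree G \<longleftrightarrow> tree_on (verts G) (ends G) (edges G)"
proof -
  have "(adjacency G)\<^sup>* = links (ends G) (edges G)"
    by (simp add: adjacency_def links_def)
  moreover have "(\<exists>xs es. is_cycle G xs es) \<longleftrightarrow>
    (\<exists>f\<in>edges G. \<exists>a b. ends G f = {a, b} \<and> (a, b) \<in> links (ends G) (edges G - {f}))"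
    using is_cycle_non_bridge non_bridge_is_cycle by metis
  ultimately show ?thesis
    by (auto simp: is_tree_def connected_multigraph_def tree_on_def)
qed

lemma spanning_trees_eq:
  "spanning_trees G = {T. T \<subseteq> edges G \<and> tree_on (verts G) (ends G) T}"
  by (simp add: spanning_trees_def is_tree_iff)

section \<open>Contraction, pendant edges and subdivision\<close>

text \<open>If \<open>e\<close> closes a cycle with \<open>T\<close>, then any other edge of that
  cycle is bypassed by way of \<open>e\<close>. Hence \<open>e\<close> is a bridge as soon as all
  the other edges are.\<close>

lemma links_exchange:
  assumes "finite T" "en e = {a, b}" "a \<noteq> b" "(a, b) \<in> links en T" "e \<notin> T"
    and "\<And>f. f \<in> T \<Longrightarrow> \<exists>p q. en f = {p, q}"
  shows "\<exists>f\<in>T. \<exists>p q. en f = {p, q} \<and> (p, q) \<in> links en (insert e (T - {f}))"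
  using assms
proof (induction T rule: finite_induct)
  case empty
  then show ?case by (simp add: links_def)
next
  case (insert f F)
  show ?case
  proof (cases "(a, b) \<in> links en F")
    case True
    then obtain g p q where g: "g \<in> F" "en g = {p, q}" "(p, q) \<in> links en (insert e (F - {g}))"
      using insert by blast
    then have "(p, q) \<in> links en (insert e (insert f F - {g}))"
      by (elim links_mono) auto
    then show ?thesis using g by blast
  next
    case False
    obtain p q where pq: "en f = {p, q}" using insert.prems by blast
    \<comment> \<open>Without \<open>f\<close> the ends of \<open>e\<close> are separated, so their
      connection runs through \<open>f\<close>. Its two remaining pieces, joined by
      \<open>e\<close>, link the ends of \<open>f\<close>.\<close>
    from insert.prems False have "(a, p) \<in> links en F \<and> (q, b) \<in> links en F \<or>
        (a, q) \<in> links en F \<and> (p, b) \<in> links en F"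
      using links_insert[of en f p q, OF pq] by blast
    then have "(p, q) \<in> links en (insert e F)"
      unfolding links_insert[of en e a b, OF \<open>en e = {a, b}\<close>]
      using links_sym by fast
    moreover have "insert f F - {f} = F" using insert by simp
    ultimately show ?thesis using pq by auto
  qed
qed

text \<open>The contraction identifies exactly the two ends of \<open>e\<close>, and
  \<open>e\<close> itself links these in \<open>G\<close>.\<close>

lemma links_contract_edge:
  fixes G :: "('v, 'e) multigraph"
  assumes e: "ends G e = {a, b}"
    and T: "\<And>f. f \<in> T \<Longrightarrow> \<exists>p q. ends G f = {p, q}"
  shows "(contract_vertex G e x, contract_vertex G e y) \<in> links (ends (contract_edge G e)) T
    \<longleftrightarrow> (x, y) \<in> links (ends G) (insert e T)"
proof -
  let ?c = "contract_vertex G e" and ?en = "ends (contract_edge G e)"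
  have en: "?en f = ?c ` ends G f" for f by (simp add: contract_edge_def)
  have same: "(u, v) \<in> links (ends G) (insert e T)" if "?c u = ?c v" for u v
  proof -
    have "u = v \<or> {u, v} = {a, b}"
      using that e by (auto simp: contract_vertex_def split: if_splits)
    then show ?thesis using e by (auto intro: links_edge)
  qed
  show ?thesis
  proof
    assume "(?c x, ?c y) \<in> links ?en T"
    \<comment> \<open>The induction runs over classes \<open>Y\<close>, so the claim has to cover
      every representative \<open>y\<close> of \<open>Y\<close>.\<close>
    moreover have "\<forall>y. Y = ?c y \<longrightarrow> (x, y) \<in> links (ends G) (insert e T)"
      if "(?c x, Y) \<in> links ?en T" for Y
      using that
    proof (induction rule: links_induct)
      case refl
      show ?case using same by blast
    next
      case (step Y Z f)
      obtain p q where pq: "ends G f = {p, q}" using T[OF \<open>f \<in> T\<close>] by blast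
      then have "{?c p, ?c q} = {Y, Z}" using step en by simp
      then obtain p' q' where pq': "ends G f = {p', q'}" "?c p' = Y" "?c q' = Z"
        using pq by (metis doubleton_eq_iff)
      then have "(x, p') \<in> links (ends G) (insert e T)" using step.IH by blast
      moreover have "(p', q') \<in> links (ends G) (insert e T)"
        using pq' step by (auto intro: links_edge)
      ultimately show ?case using same pq' links_trans by metis
    qed
    ultimately show "(x, y) \<in> links (ends G) (insert e T)" by blast
  next
    assume "(x, y) \<in> links (ends G) (insert e T)"
    then show "(?c x, ?c y) \<in> links ?en T"
    proof (induction rule: links_induct)
      case refl
      show ?case by simp
    next
      case (step y z f)
      have "(?c y, ?c z) \<in> links ?en T"
      proof (cases "f = e")
        case True
        then have "?c y = ?c z" using step by (auto simp: contract_vertex_def)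
        then show ?thesis by simp
      next
        case False
        then show ?thesis using step en by (auto intro!: links_edge[of f])
      qed
      then show ?case using step.IH links_trans by metis
    qed
  qed
qed

text \<open>Connectedness and the bridge conditions on \<open>T\<close> carry over by
  \<open>links_contract_edge\<close>. The only further condition, that \<open>e\<close> is a bridge,
  follows from the others by \<open>links_exchange\<close>.\<close>

lemma tree_on_contract_edge:
  fixes G :: "('v, 'e) multigraph"
  assumes e: "ends G e = {a, b}" "a \<noteq> b" "e \<notin> T" and fin: "finite T"
    and T: "\<And>f. f \<in> T \<Longrightarrow> \<exists>p q. ends G f = {p, q}"
  shows "tree_on (verts (contract_edge G e)) (ends (contract_edge G e)) T \<longleftrightarrow>
    tree_on (verts G) (ends G) (insert e T)"
proof -
  let ?c = "contract_vertex G e" and ?en = "ends (contract_edge G e)"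
  have en: "?en f = ?c ` ends G f" for f by (simp add: contract_edge_def)
  have vs: "verts (contract_edge G e) = ?c ` verts G" by (simp add: contract_edge_def)
  have conn: "(\<forall>x\<in>?c ` verts G. \<forall>y\<in>?c ` verts G. (x, y) \<in> links ?en T) \<longleftrightarrow>
      (\<forall>x\<in>verts G. \<forall>y\<in>verts G. (x, y) \<in> links (ends G) (insert e T))"
    using links_contract_edge[OF e(1) T] by simp
  have bridge: "(\<forall>A B. ?en f = {A, B} \<longrightarrow> (A, B) \<notin> links ?en (T - {f})) \<longleftrightarrow>
      (\<forall>a b. ends G f = {a, b} \<longrightarrow> (a, b) \<notin> links (ends G) (insert e T - {f}))"
    if f: "f \<in> T" for f
  proof -
    have ins: "insert e T - {f} = insert e (T - {f})" using f e by auto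
    have eq: "(?c x, ?c y) \<in> links ?en (T - {f}) \<longleftrightarrow>
        (x, y) \<in> links (ends G) (insert e T - {f})" for x y
      unfolding ins by (rule links_contract_edge[OF e(1)]) (use T in auto)
    obtain p q where pq: "ends G f = {p, q}" using T f by blast
    have "(\<forall>A B. ?en f = {A, B} \<longrightarrow> (A, B) \<notin> links ?en (T - {f})) \<longleftrightarrow>
        (?c p, ?c q) \<notin> links ?en (T - {f})"
      using pq links_sym by (fastforce simp: en doubleton_eq_iff)
    moreover have "(\<forall>a b. ends G f = {a, b} \<longrightarrow> (a, b) \<notin> links (ends G) (insert e T - {f}))
        \<longleftrightarrow> (p, q) \<notin> links (ends G) (insert e T - {f})"
      using pq links_sym by (fastforce simp: doubleton_eq_iff)
    ultimately show ?thesis using eq by simp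
  qed
  have e_bridge: "(x, y) \<notin> links (ends G) (insert e T - {e})"
    if br: "\<And>f a b. f \<in> T \<Longrightarrow> ends G f = {a, b} \<Longrightarrow>
        (a, b) \<notin> links (ends G) (insert e T - {f})" and xy: "ends G e = {x, y}" for x y
  proof
    assume "(x, y) \<in> links (ends G) (insert e T - {e})"
    then have "(x, y) \<in> links (ends G) T" using e by simp
    moreover have "x \<noteq> y" using xy e by auto
    ultimately obtain f p q where f: "f \<in> T" "ends G f = {p, q}"
        "(p, q) \<in> links (ends G) (insert e (T - {f}))"
      using links_exchange[of T "ends G" e x y] fin xy e T by blast
    moreover have "insert e (T - {f}) = insert e T - {f}" using f e by auto
    ultimately show False using br by auto
  qed
  let ?B = "\<lambda>f. \<forall>a b. ends G f = {a, b} \<longrightarrow> (a, b) \<notin> links (ends G) (insert e T - {f})"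
  have "?B e" if "\<forall>f\<in>T. ?B f" using e_bridge that by metis
  then have "(\<forall>f\<in>insert e T. ?B f) \<longleftrightarrow> (\<forall>f\<in>T. ?B f)" by (simp only: ball_simps) metis
  also have "\<dots> \<longleftrightarrow> (\<forall>f\<in>T. \<forall>A B. ?en f = {A, B} \<longrightarrow> (A, B) \<notin> links ?en (T - {f}))"
    by (intro ball_cong refl bridge[symmetric])
  finally show ?thesis
    by (simp only: tree_on_def vs conn image_is_empty)
qed

text \<open>This moves the count from the quotient back into \<open>G\<close>, so that both
  coordinates of a feasible vector count edge sets over one vertex set.\<close>

lemma tau_contract_edge:
  fixes G :: "('v, 'e) multigraph"
  assumes "finite_multigraph G" "simple_multigraph G" "e \<in> edges G"
  shows "tau (contract_edge G e) =
    card {T. T \<subseteq> edges G - {e} \<and> tree_on (verts G) (ends G) (insert e T)}"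
proof -
  have two: "\<exists>p q. ends G f = {p, q} \<and> p \<noteq> q" if "f \<in> edges G" for f
  proof -
    have "card (ends G f) = 2" using assms(2) that by (simp add: simple_multigraph_def)
    then show ?thesis unfolding card_2_iff by blast
  qed
  then obtain a b where ab: "ends G e = {a, b}" "a \<noteq> b" using assms by blast
  have "tree_on (verts (contract_edge G e)) (ends (contract_edge G e)) T \<longleftrightarrow>
      tree_on (verts G) (ends G) (insert e T)" if "T \<subseteq> edges G - {e}" for T
  proof (rule tree_on_contract_edge[OF ab])
    show "finite T"
      using that assms(1) by (auto simp: finite_multigraph_def intro: finite_subset)
  qed (use that two in blast)+
  then have "spanning_trees (contract_edge G e) =
      {T. T \<subseteq> edges G - {e} \<and> tree_on (verts G) (ends G) (insert e T)}"
    unfolding spanning_trees_eq by (auto simp: contract_edge_def)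
  then show ?thesis by (simp add: tau_def)
qed

lemma tau_delete_edge:
  "tau (delete_edge G e) = card {T. T \<subseteq> edges G - {e} \<and> tree_on (verts G) (ends G) T}"
  by (simp add: tau_def spanning_trees_eq delete_edge_def)

text \<open>No edge of \<open>T\<close> meets \<open>w\<close>, so \<open>d\<close> is a bridge and
  creates no link between old vertices.\<close>

lemma tree_on_pendant:
  assumes T: "\<And>f. f \<in> T \<Longrightarrow> en f \<subseteq> V" and w: "w \<notin> V" and d: "en d = {y, w}" and y: "y \<in> V"
  shows "tree_on (insert w V) en (insert d T) \<longleftrightarrow> tree_on V en T"
proof -
  have "d \<notin> T" using T d w by blast
  have iso: "(w, z) \<in> links en U \<longleftrightarrow> z = w" "(z, w) \<in> links en U \<longleftrightarrow> z = w"
    if "U \<subseteq> T" for U z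
    using links_isolated[of U w en z] that T w by blast+
  have old: "(p, q) \<in> links en (insert d U) \<longleftrightarrow> (p, q) \<in> links en U"
    if "U \<subseteq> T" "p \<noteq> w" "q \<noteq> w" for U p q
    unfolding links_insert[of en d, OF d] using iso[OF that(1)] that by auto
  have new: "(w, q) \<in> links en (insert d T) \<longleftrightarrow> q = w \<or> (y, q) \<in> links en T" for q
    unfolding links_insert[of en d, OF d] using iso[of T] by auto
  have conn: "(\<forall>p\<in>insert w V. \<forall>q\<in>insert w V. (p, q) \<in> links en (insert d T)) \<longleftrightarrow>
      (\<forall>p\<in>V. \<forall>q\<in>V. (p, q) \<in> links en T)" (is "?L \<longleftrightarrow> ?R")
  proof
    show "?L \<Longrightarrow> ?R" using old[of T] w by (metis insertCI subset_refl)
    assume R: ?R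
    show ?L
    proof (intro ballI)
      fix p q assume "p \<in> insert w V" "q \<in> insert w V"
      then show "(p, q) \<in> links en (insert d T)"
        using R new[of p] new[of q] old[of T p q] w y links_sym by (metis insertE subset_refl)
    qed
  qed
  have bridge: "(en f = {p, q} \<longrightarrow> (p, q) \<notin> links en (insert d T - {f})) \<longleftrightarrow>
      (en f = {p, q} \<longrightarrow> (p, q) \<notin> links en (T - {f}))"
    if "f \<in> T" for f p q
  proof (intro imp_cong refl)
    assume "en f = {p, q}"
    have "insert d T - {f} = insert d (T - {f})" using that \<open>d \<notin> T\<close> by auto
    moreover have "p \<noteq> w" "q \<noteq> w" using T[OF that] \<open>en f = {p, q}\<close> w by auto
    ultimately show "(p, q) \<notin> links en (insert d T - {f}) \<longleftrightarrow> (p, q) \<notin> links en (T - {f})"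
      using old[of "T - {f}" p q] by auto
  qed
  have d_bridge: "(p, q) \<notin> links en (insert d T - {d})" if "en d = {p, q}" for p q
  proof -
    have "p = w \<and> q = y \<or> p = y \<and> q = w" using that d by (auto simp: doubleton_eq_iff)
    moreover have "y \<noteq> w" using y w by blast
    ultimately show ?thesis using iso[of T] \<open>d \<notin> T\<close> by auto
  qed
  have "(\<forall>f\<in>insert d T. \<forall>p q. en f = {p, q} \<longrightarrow> (p, q) \<notin> links en (insert d T - {f})) \<longleftrightarrow>
      (\<forall>f\<in>T. \<forall>p q. en f = {p, q} \<longrightarrow> (p, q) \<notin> links en (T - {f}))"
    using bridge d_bridge by (simp cong: ball_cong)
  then show ?thesis
    unfolding tree_on_def conn using y by blast
qed

text \<open>The path \<open>x\<close>, \<open>w\<close>, \<open>y\<close> creates the same links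
  between old vertices as \<open>e\<close> does, and each of its halves is a bridge exactly if
  \<open>e\<close> is.\<close>

lemma tree_on_subdivide:
  assumes T: "\<And>f. f \<in> T \<Longrightarrow> en f \<subseteq> V" and w: "w \<notin> V"
    and g: "en g = {x, w}" and d: "en d = {y, w}" and e: "en e = {x, y}" "e \<notin> T"
    and xy: "x \<in> V" "y \<in> V" "x \<noteq> y"
  shows "tree_on (insert w V) en (insert g (insert d T)) \<longleftrightarrow> tree_on V en (insert e T)"
proof -
  have gd: "g \<notin> T" "d \<notin> T" "g \<noteq> d" using T g d w xy by (blast, blast, auto simp: doubleton_eq_iff)
  have xyw: "x \<noteq> w" "y \<noteq> w" using xy w by auto
  have iso: "(w, z) \<in> links en U \<longleftrightarrow> z = w" "(z, w) \<in> links en U \<longleftrightarrow> z = w"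
    if "U \<subseteq> T" for U z
    using links_isolated[of U w en z] that T w by blast+
  have old: "(p, q) \<in> links en (insert g (insert d U)) \<longleftrightarrow> (p, q) \<in> links en (insert e U)"
    if "U \<subseteq> T" "p \<noteq> w" "q \<noteq> w" for U p q
    unfolding links_insert[of en d, OF d] links_insert[of en g, OF g] links_insert[of en e, OF e(1)]
    using iso[OF that(1)] that xyw links_trans[of _ _ en U] links_sym[of _ _ en U]
    by (smt (verit) links_refl)
  have new: "(x, w) \<in> links en (insert g (insert d T))"
    using g by (auto intro: links_edge)
  have conn: "(\<forall>p\<in>insert w V. \<forall>q\<in>insert w V. (p, q) \<in> links en (insert g (insert d T))) \<longleftrightarrow>
      (\<forall>p\<in>V. \<forall>q\<in>V. (p, q) \<in> links en (insert e T))" (is "?L \<longleftrightarrow> ?R")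
  proof
    show "?L \<Longrightarrow> ?R" using old[of T] w by (metis insertCI subset_refl)
    assume R: ?R
    have *: "(x, p) \<in> links en (insert g (insert d T))" if "p \<in> insert w V" for p
      using R new old[of T x p] w xy that by (metis insertE subset_refl)
    show ?L using * links_sym links_trans by metis
  qed
  have bridge: "(en f = {p, q} \<longrightarrow> (p, q) \<notin> links en (insert g (insert d T) - {f})) \<longleftrightarrow>
      (en f = {p, q} \<longrightarrow> (p, q) \<notin> links en (insert e T - {f}))"
    if "f \<in> T" for f p q
  proof (intro imp_cong refl)
    assume "en f = {p, q}"
    have "insert g (insert d T) - {f} = insert g (insert d (T - {f}))"
      "insert e T - {f} = insert e (T - {f})" using that gd e by auto
    moreover have "p \<noteq> w" "q \<noteq> w" using T[OF that] \<open>en f = {p, q}\<close> w by auto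
    ultimately show "(p, q) \<notin> links en (insert g (insert d T) - {f}) \<longleftrightarrow>
        (p, q) \<notin> links en (insert e T - {f})"
      using old[of "T - {f}" p q] by auto
  qed
  have symm: "(\<forall>p q. en h = {p, q} \<longrightarrow> (p, q) \<notin> links en U) \<longleftrightarrow> (a, b) \<notin> links en U"
    if "en h = {a, b}" for h a b U
    using that links_sym by (fastforce simp: doubleton_eq_iff)
  have "insert g (insert d T) - {g} = insert d T" "insert g (insert d T) - {d} = insert g T"
    "insert e T - {e} = T" using gd e by auto
  \<comment> \<open>Without \<open>g\<close> the vertex \<open>w\<close> hangs at \<open>y\<close>,
    and without \<open>d\<close> it hangs at \<open>x\<close>. So each half is bypassed precisely
    when \<open>T\<close> links \<open>x\<close> and \<open>y\<close>.\<close>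
  moreover have "(x, w) \<in> links en (insert d T) \<longleftrightarrow> (x, y) \<in> links en T"
    unfolding links_insert[of en d, OF d] using iso[of T] xyw by auto
  moreover have "(y, w) \<in> links en (insert g T) \<longleftrightarrow> (x, y) \<in> links en T"
    unfolding links_insert[of en g, OF g] using iso[of T] xyw links_sym[of _ _ en T] by auto
  ultimately have ends: "(\<forall>p q. en g = {p, q} \<longrightarrow> (p, q) \<notin> links en (insert g (insert d T) - {g}))
      \<longleftrightarrow> (\<forall>p q. en e = {p, q} \<longrightarrow> (p, q) \<notin> links en (insert e T - {e}))"
    "(\<forall>p q. en d = {p, q} \<longrightarrow> (p, q) \<notin> links en (insert g (insert d T) - {d}))
      \<longleftrightarrow> (\<forall>p q. en e = {p, q} \<longrightarrow> (p, q) \<notin> links en (insert e T - {e}))"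
    using symm[OF g] symm[OF d] symm[OF e(1)] by auto
  have "(\<forall>f\<in>insert g (insert d T). \<forall>p q. en f = {p, q} \<longrightarrow>
        (p, q) \<notin> links en (insert g (insert d T) - {f})) \<longleftrightarrow>
      (\<forall>f\<in>insert e T. \<forall>p q. en f = {p, q} \<longrightarrow> (p, q) \<notin> links en (insert e T - {f}))"
    unfolding ball_simps ends using bridge by (simp cong: ball_cong)
  then show ?thesis
    unfolding tree_on_def conn using xy by blast
qed

section \<open>Fans\<close>

text \<open>
  Vertex \<open>0\<close> is the hub and \<open>1, 2, \<dots>\<close> is the path; edge \<open>2 * i\<close> joins the path vertices
  \<open>i + 1\<close> and \<open>i + 2\<close>, edge \<open>2 * i + 1\<close> is the spoke to the path vertex \<open>i + 1\<close>.
\<close>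

definition fan_ends :: "nat \<Rightarrow> nat set" where
  "fan_ends f = (if even f then {f div 2 + 1, f div 2 + 2} else {0, f div 2 + 1})"

definition fan :: "nat \<Rightarrow> nat set \<Rightarrow> (nat, nat) multigraph" where
  "fan n E = \<lparr>verts = {..n + 1}, edges = E, ends = fan_ends\<rparr>"

lemma fan_simps [simp]:
  "verts (fan n E) = {..n + 1}" "edges (fan n E) = E" "ends (fan n E) = fan_ends"
  by (simp_all add: fan_def)

lemma fan_ends_simps [simp]:
  "fan_ends (2 * n) = {n + 1, n + 2}"
  "fan_ends (2 * n + 1) = {0, n + 1}"
  "fan_ends (Suc (2 * n)) = {0, n + 1}"
  by (simp_all add: fan_ends_def)

text \<open>Among the edge codes below \<open>2 * n + 2\<close>, only the path edge
  \<open>2 * n\<close> reaches the vertex \<open>n + 2\<close>.\<close>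

lemma fan_ends_subset: "f < 2 * n + 2 \<Longrightarrow> f \<noteq> 2 * n \<Longrightarrow> fan_ends f \<subseteq> {..n + 1}"
  by (auto simp: fan_ends_def elim!: evenE)

lemma inj_fan_ends: "inj fan_ends"
proof (rule injI)
  fix f g assume "fan_ends f = fan_ends g"
  then show "f = g"
    by (auto simp: fan_ends_def doubleton_eq_iff elim!: evenE oddE split: if_splits)
qed

lemma fan_finite_simple:
  assumes "H \<subseteq> {..<2 * n}"
  shows "finite_multigraph (fan n (insert (2 * n + 1) H))"
    and "simple_multigraph (fan n (insert (2 * n + 1) H))"
proof -
  have two: "card (fan_ends f) = 2" for f by (auto simp: fan_ends_def)
  have "fan_ends f \<subseteq> {..n + 1}" if "f \<in> insert (2 * n + 1) H" for f
    using that assms by (intro fan_ends_subset) auto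
  moreover have "finite H" using assms finite_subset by blast
  ultimately show "finite_multigraph (fan n (insert (2 * n + 1) H))"
    using two by (auto simp: finite_multigraph_def)
  show "simple_multigraph (fan n (insert (2 * n + 1) H))"
    using two inj_on_subset[OF inj_fan_ends subset_UNIV]
    by (simp add: simple_multigraph_def del: inj_on_insert)
qed

section \<open>Straight-line drawings of fans\<close>

definition fan_point :: "nat \<Rightarrow> complex" where
  "fan_point k = (if k = 0 then \<i> else of_nat k)"

definition fan_path :: "nat \<Rightarrow> real \<Rightarrow> complex" where
  "fan_path f = (if even f then linepath (of_nat (f div 2 + 1)) (of_nat (f div 2 + 2))
                 else linepath \<i> (of_nat (f div 2 + 1)))"

lemma fan_point_simps: "Re (fan_point k) = real k" "Im (fan_point k) = (if k = 0 then 1 else 0)"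
  by (auto simp: fan_point_def)

text \<open>The parameter of the segment is determined by \<open>Re z\<close> on a path edge and by
  \<open>Im z\<close> on a spoke. Eliminating it turns questions about crossings into
  arithmetic.\<close>

lemma path_image_fan_path:
  "z \<in> path_image (fan_path (2 * i)) \<longleftrightarrow> Im z = 0 \<and> real i + 1 \<le> Re z \<and> Re z \<le> real i + 2"
  "z \<in> path_image (fan_path (2 * i + 1)) \<longleftrightarrow>
     0 \<le> Im z \<and> Im z \<le> 1 \<and> Re z = (1 - Im z) * (real i + 1)"
proof -
  have "z \<in> path_image (fan_path (2 * i)) \<longleftrightarrow>
      (\<exists>u. z = (1 - u) *\<^sub>R of_nat (i + 1) + u *\<^sub>R of_nat (i + 2) \<and> 0 \<le> u \<and> u \<le> 1)"
    by (simp add: fan_path_def in_segment conj_ac)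
  also have "\<dots> \<longleftrightarrow> (\<exists>u. u = Re z - real i - 1 \<and> Im z = 0 \<and> 0 \<le> u \<and> u \<le> 1)"
    by (intro ex_cong1) (auto simp: complex_eq_iff algebra_simps)
  also have "\<dots> \<longleftrightarrow> Im z = 0 \<and> real i + 1 \<le> Re z \<and> Re z \<le> real i + 2" by auto
  finally show "z \<in> path_image (fan_path (2 * i)) \<longleftrightarrow> \<dots>" .
  have "z \<in> path_image (fan_path (2 * i + 1)) \<longleftrightarrow>
      (\<exists>u. z = (1 - u) *\<^sub>R \<i> + u *\<^sub>R of_nat (i + 1) \<and> 0 \<le> u \<and> u \<le> 1)"
    by (simp add: fan_path_def in_segment conj_ac)
  also have "\<dots> \<longleftrightarrow> (\<exists>u. u = 1 - Im z \<and> Re z = u * (real i + 1) \<and> 0 \<le> u \<and> u \<le> 1)"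
    by (intro ex_cong1) (auto simp: complex_eq_iff algebra_simps)
  also have "\<dots> \<longleftrightarrow> 0 \<le> Im z \<and> Im z \<le> 1 \<and> Re z = (1 - Im z) * (real i + 1)" by auto
  finally show "z \<in> path_image (fan_path (2 * i + 1)) \<longleftrightarrow> \<dots>" .
qed

lemma fan_path_interior:
  "z \<in> path_image (fan_path (2 * i)) - fan_point ` fan_ends (2 * i) \<longleftrightarrow>
     Im z = 0 \<and> real i + 1 < Re z \<and> Re z < real i + 2"
  "z \<in> path_image (fan_path (2 * i + 1)) - fan_point ` fan_ends (2 * i + 1) \<longleftrightarrow>
     0 < Im z \<and> Im z < 1 \<and> Re z = (1 - Im z) * (real i + 1)"
  unfolding Diff_iff path_image_fan_path
  by (cases "Im z = 0"; auto simp: complex_eq_iff fan_point_simps)+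

text \<open>The path edges lie end to end on the real axis, and the spokes run from
  \<open>\<i>\<close> to distinct points of that axis, so edges meet only at common ends.\<close>

lemma planar_fan: "planar_multigraph (fan n E)"
proof -
  have inj: "inj fan_point"
    by (rule injI) (simp add: complex_eq_iff fan_point_simps)
  have simple: "simple_path (fan_path f)" for f
    by (auto simp: fan_path_def complex_eq_iff intro!: arc_imp_simple_path arc_linepath)
  have joins: "{pathstart (fan_path f), pathfinish (fan_path f)} = fan_point ` fan_ends f" for f
    by (auto simp: fan_path_def fan_ends_def fan_point_def)
  have vertex: "fan_point k \<notin> path_image (fan_path f) - fan_point ` fan_ends f" for f k
  proof (cases "even f")
    case True
    then obtain i where "f = 2 * i" by blast
    moreover have "\<not> (real (i + 1) < real k \<and> real k < real (i + 2))"
      unfolding of_nat_less_iff by linarith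
    ultimately show ?thesis by (simp only: fan_path_interior fan_point_simps) auto
  next
    case False
    then obtain i where "f = 2 * i + 1" by (blast elim: oddE)
    then show ?thesis by (simp only: fan_path_interior fan_point_simps) auto
  qed
  have cross: False
    if fg: "f \<noteq> g" and z: "z \<in> path_image (fan_path f) - fan_point ` fan_ends f"
      "z \<in> path_image (fan_path g)" for f g z
  proof (cases "even f")
    case True
    then obtain i where i: "f = 2 * i" by blast
    have zi: "Im z = 0" "real i + 1 < Re z" "Re z < real i + 2"
      using z(1) unfolding i fan_path_interior by auto
    show False
    proof (cases "even g")
      case True
      then obtain j where j: "g = 2 * j" by blast
      then have "real j + 1 \<le> Re z" "Re z \<le> real j + 2"
        using z(2) unfolding j path_image_fan_path by auto
      then have "real i < real (j + 1)" "real j < real (i + 1)" using zi by auto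
      then have "i = j" unfolding of_nat_less_iff by linarith
      then show False using fg i j by simp
    next
      case False
      then obtain j where j: "g = 2 * j + 1" by (blast elim: oddE)
      \<comment> \<open>A spoke meets the real axis only at its integer foot, but \<open>z\<close>
        lies strictly between consecutive integers.\<close>
      then have "Re z = real j + 1"
        using z(2) zi unfolding j path_image_fan_path by auto
      then have "real i < real j" "real j < real (i + 1)" using zi by auto
      then show False unfolding of_nat_less_iff by linarith
    qed
  next
    case False
    then obtain i where i: "f = 2 * i + 1" by (blast elim: oddE)
    have zi: "0 < Im z" "Im z < 1" "Re z = (1 - Im z) * (real i + 1)"
      using z(1) unfolding i fan_path_interior by auto
    show False
    proof (cases "even g")
      case True
      then obtain j where j: "g = 2 * j" by blast
      show False using z(2) zi unfolding j path_image_fan_path by auto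
    next
      case False
      then obtain j where j: "g = 2 * j + 1" by (blast elim: oddE)
      \<comment> \<open>At a height below 1, distinct spokes have different real parts.\<close>
      have "Re z = (1 - Im z) * (real j + 1)"
        using z(2) unfolding j path_image_fan_path by auto
      then show False using zi fg i j by auto
    qed
  qed
  have "plane_drawing (fan n E) fan_point fan_path"
    unfolding plane_drawing_def fan_simps
  proof (intro conjI ballI impI)
    show "inj_on fan_point {..n + 1}" by (rule inj_on_subset[OF inj subset_UNIV])
    show "simple_path (fan_path f)" for f by (rule simple)
    show "{pathstart (fan_path f), pathfinish (fan_path f)} = fan_point ` fan_ends f" for f
      by (rule joins)
    show "(path_image (fan_path f) - fan_point ` fan_ends f) \<inter> fan_point ` {..n + 1} = {}" for f
      using vertex[of _ f] by blast
    show "(path_image (fan_path f) - fan_point ` fan_ends f) \<inter> path_image (fan_path g) = {}"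
      if "g \<noteq> f" for f g
      using cross[OF that[symmetric]] by blast
  qed
  then show ?thesis by (auto simp: planar_multigraph_def)
qed

section \<open>The recursion for the feasible vectors of fans\<close>

text \<open>\<open>H\<close> is the edge set without the distinguished spoke
  \<open>2 * n + 1\<close>. By \<open>tau_contract_edge\<close> this is the first coordinate of the
  vector.\<close>

definition fan_contract_count :: "nat \<Rightarrow> nat set \<Rightarrow> nat" where
  "fan_contract_count n H = card {T. T \<subseteq> H \<and> tree_on {..n + 1} fan_ends (insert (2 * n + 1) T)}"

definition fan_delete_count :: "nat \<Rightarrow> nat set \<Rightarrow> nat" where
  "fan_delete_count n H = card {T. T \<subseteq> H \<and> tree_on {..n + 1} fan_ends T}"

lemma planar_feasible_fan:
  assumes "H \<subseteq> {..<2 * n}"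
  shows "planar_feasible (n + 2) (int (fan_contract_count n H), int (fan_delete_count n H))"
proof -
  let ?G = "fan n (insert (2 * n + 1) H)" and ?e = "2 * n + 1"
  have "insert ?e H - {?e} = H" using assms by auto
  then have "tau (contract_edge ?G ?e) = fan_contract_count n H"
    "tau (delete_edge ?G ?e) = fan_delete_count n H"
    using tau_contract_edge[OF fan_finite_simple[OF assms], of ?e]
    by (simp_all add: tau_delete_edge fan_contract_count_def fan_delete_count_def)
  moreover have "card (verts ?G) \<le> n + 2" "?e \<in> edges ?G" by simp_all
  ultimately show ?thesis
    unfolding planar_feasible_def using fan_finite_simple[OF assms] planar_fan by metis
qed

text \<open>The deletion-contraction principle: the sets are split according to whether they contain
  \<open>e\<close>.\<close>

lemma card_subsets_insert:
  assumes "finite H" "e \<notin> H"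
  shows "card {T. T \<subseteq> insert e H \<and> P T} =
    card {T. T \<subseteq> H \<and> P T} + card {T. T \<subseteq> H \<and> P (insert e T)}"
proof -
  let ?A = "{T. T \<subseteq> H \<and> P T}" and ?B = "{T. T \<subseteq> H \<and> P (insert e T)}"
  have "{T. T \<subseteq> insert e H \<and> P T} = ?A \<union> insert e ` ?B"
  proof (intro equalityI subsetI)
    fix T assume T: "T \<in> {T. T \<subseteq> insert e H \<and> P T}"
    show "T \<in> ?A \<union> insert e ` ?B"
    proof (cases "e \<in> T")
      case True
      then have "T = insert e (T - {e})" by auto
      then show ?thesis using T by (intro UnI2 image_eqI[of _ _ "T - {e}"]) auto
    qed (use T in auto)
  qed auto
  moreover have "finite ?A" "finite ?B" using assms by auto
  moreover have "?A \<inter> insert e ` ?B = {}" using assms by auto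
  moreover have "inj_on (insert e) ?B"
    using assms by (intro inj_onI) (metis (no_types, lifting) insert_ident mem_Collect_eq subsetD)
  ultimately show ?thesis by (simp add: card_Un_disjoint card_image)
qed

text \<open>The new vertex \<open>n + 2\<close> meets only the path edge \<open>2 * n\<close> and
  the new spoke \<open>2 * n + 3\<close>. In the deletion count the path edge is pendant. In the
  contraction count the new spoke is present: if the path edge is missing, the spoke is pendant;
  otherwise the two edges subdivide the old spoke \<open>2 * n + 1\<close>.\<close>

lemma fan_counts_step:
  assumes K: "K \<subseteq> {..<2 * n + 2} - {2 * n}"
  shows "fan_delete_count (Suc n) (insert (2 * n) K) = fan_delete_count n K"
    and "fan_contract_count (Suc n) (insert (2 * n) K) =
      fan_delete_count n K + fan_contract_count n (K - {2 * n + 1})"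
proof -
  let ?d = "2 * n" and ?e = "2 * n + 1" and ?g = "2 * Suc n + 1" and ?V = "{..n + 1}"
  have V: "{..Suc n + 1} = insert (n + 2) ?V" by auto
  have finK: "finite K" using K finite_subset by blast
  have d: "?d \<notin> K" using K by auto
  have sub: "fan_ends f \<subseteq> ?V" if "f \<in> K" for f
    using that K by (intro fan_ends_subset) auto
  have isolated: "\<not> tree_on (insert (n + 2) ?V) fan_ends T" if "T \<subseteq> K" for T
  proof
    assume "tree_on (insert (n + 2) ?V) fan_ends T"
    then have "(n + 2, 0) \<in> links fan_ends T" by (auto simp: tree_on_def)
    moreover have "n + 2 \<notin> fan_ends f" if "f \<in> T" for f
      using sub[of f] that \<open>T \<subseteq> K\<close> by fastforce
    ultimately show False using links_isolated(1)[of T "n + 2" fan_ends 0] by auto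
  qed
  have pend: "tree_on (insert (n + 2) ?V) fan_ends (insert c T) \<longleftrightarrow> tree_on ?V fan_ends T"
    if "T \<subseteq> K" "c = ?d \<or> c = ?g" for T c
  proof -
    have "\<exists>y\<in>?V. fan_ends c = {y, n + 2}"
      using that(2) fan_ends_simps(1)[of n] fan_ends_simps(2)[of "Suc n"]
      by (metis One_nat_def Suc_eq_plus1 add_2_eq_Suc' atMost_iff le_refl zero_le)
    then obtain y where "y \<in> ?V" "fan_ends c = {y, n + 2}" by blast
    then show ?thesis using that sub by (intro tree_on_pendant) auto
  qed
  show "fan_delete_count (Suc n) (insert ?d K) = fan_delete_count n K"
    unfolding fan_delete_count_def V card_subsets_insert[OF finK d]
    using isolated pend by (simp cong: conj_cong)
  have subdiv: "tree_on (insert (n + 2) ?V) fan_ends (insert ?g (insert ?d T)) \<longleftrightarrow>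
      ?e \<notin> T \<and> tree_on ?V fan_ends (insert ?e T)" if T: "T \<subseteq> K" for T
  proof (cases "?e \<in> T")
    case True
    let ?U = "insert ?g (insert ?d T) - {?e}"
    \<comment> \<open>The edges \<open>?e\<close>, \<open>?g\<close> and \<open>?d\<close> form a
      triangle, so \<open>?e\<close> is not a bridge.\<close>
    have "?g \<in> ?U" "?d \<in> ?U" by simp_all
    moreover have "fan_ends ?g = {0, n + 2}" "fan_ends ?d = {n + 2, n + 1}"
      using fan_ends_simps(2)[of "Suc n"] by auto
    ultimately have "(0, n + 1) \<in> links fan_ends ?U"
      using links_edge links_trans by metis
    then show ?thesis using True fan_ends_simps(2)[of n] unfolding tree_on_def by blast
  next
    case False
    then show ?thesis
      using T sub fan_ends_simps(2)[of "Suc n"]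
      by (simp only: simp_thms, intro tree_on_subdivide[where x = 0 and y = "n + 1"]) auto
  qed
  have *: "{T. T \<subseteq> K \<and> ?e \<notin> T \<and> tree_on ?V fan_ends (insert ?e T)} =
      {T. T \<subseteq> K - {?e} \<and> tree_on ?V fan_ends (insert ?e T)}" by auto
  show "fan_contract_count (Suc n) (insert ?d K) =
      fan_delete_count n K + fan_contract_count n (K - {?e})"
    unfolding fan_contract_count_def fan_delete_count_def V card_subsets_insert[OF finK d] *[symmetric]
    using pend subdiv by (simp cong: conj_cong del: One_nat_def)
qed

text \<open>Deletion-contraction at the old spoke: keeping it replaces \<open>u\<close> by
  \<open>t + u\<close> before the next vertex is added.\<close>

lemma fan_delete_count_insert_spoke:
  assumes "H \<subseteq> {..<2 * n}"
  shows "fan_delete_count n (insert (2 * n + 1) H) = fan_delete_count n H + fan_contract_count n H"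
  unfolding fan_delete_count_def fan_contract_count_def
  using assms finite_subset by (intro card_subsets_insert) auto

section \<open>Vectors generated from \<open>(1, 0)\<close> by the two steps\<close>

fun pass_step :: "int \<times> int \<Rightarrow> int \<times> int" where
  "pass_step (t, u) = (t + u, u)"

text \<open>This is \<open>pass_step\<close> applied to \<open>(t, t + u)\<close>, the pair obtained
  when the old spoke is restored.\<close>

fun keep_step :: "int \<times> int \<Rightarrow> int \<times> int" where
  "keep_step (t, u) = (2 * t + u, t + u)"

primrec fan_vectors :: "nat \<Rightarrow> (int \<times> int) set" where
  "fan_vectors 0 = {(1, 0)}"
| "fan_vectors (Suc n) = pass_step ` fan_vectors n \<union> keep_step ` fan_vectors n"

lemma fan_vectors_realised:
  "v \<in> fan_vectors n \<Longrightarrow>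
    \<exists>H\<subseteq>{..<2 * n}. v = (int (fan_contract_count n H), int (fan_delete_count n H))"
proof (induction n arbitrary: v)
  case 0
  have V: "{..0 + 1 :: nat} = insert 1 {0}" by auto
  have one: "tree_on {0 :: nat} fan_ends {}" by (simp add: tree_on_def)
  \<comment> \<open>Here 1 is both the first path vertex and the code \<open>2 * 0 + 1\<close> of
    its spoke.\<close>
  have "tree_on (insert 1 {0}) fan_ends (insert 1 {})"
    using tree_on_pendant[of "{}" fan_ends "{0}" 1 1 0] one fan_ends_simps(2)[of 0] by simp
  moreover have "\<not> tree_on (insert 1 {0}) fan_ends {}"
    using links_isolated(1)[of "{}" 1 fan_ends 0] by (auto simp: tree_on_def)
  ultimately have "fan_contract_count 0 {} = 1" "fan_delete_count 0 {} = 0"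
    unfolding fan_contract_count_def fan_delete_count_def V by (simp_all cong: conj_cong)
  then show ?case using 0 by auto
next
  case (Suc n)
  then obtain w where w: "w \<in> fan_vectors n" "v = pass_step w \<or> v = keep_step w" by auto
  then obtain H where H: "H \<subseteq> {..<2 * n}"
    "w = (int (fan_contract_count n H), int (fan_delete_count n H))"
    using Suc.IH by blast
  \<comment> \<open>Keeping the old spoke means adding it to \<open>H\<close> before the path is
    prolonged.\<close>
  let ?K = "insert (2 * n + 1) H"
  have *: "H - {2 * n + 1} = H" "?K - {2 * n + 1} = H"
    "H \<subseteq> {..<2 * n + 2} - {2 * n}" "?K \<subseteq> {..<2 * n + 2} - {2 * n}"
    "insert (2 * n) H \<subseteq> {..<2 * Suc n}" "insert (2 * n) ?K \<subseteq> {..<2 * Suc n}"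
    using H(1) by auto
  from w(2) show ?case
  proof
    assume "v = pass_step w"
    then have "v = (int (fan_contract_count (Suc n) (insert (2 * n) H)),
        int (fan_delete_count (Suc n) (insert (2 * n) H)))"
      unfolding fan_counts_step[OF *(3)] *(1) H(2) by simp
    then show ?thesis using *(5) by blast
  next
    assume "v = keep_step w"
    then have "v = (int (fan_contract_count (Suc n) (insert (2 * n) ?K)),
        int (fan_delete_count (Suc n) (insert (2 * n) ?K)))"
      unfolding fan_counts_step[OF *(4)] *(2) H(2) fan_delete_count_insert_spoke[OF H(1)] by simp
    then show ?thesis using *(6) by blast
  qed
qed

text \<open>Both steps increase the difference of the coordinates or leave it positive, because
  \<open>t\<close> is positive. The bounds serve to separate the images of the two steps.\<close>

lemma fan_vectors_bounds: "(t, u) \<in> fan_vectors n \<Longrightarrow> 0 \<le> u \<and> u < t"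
  by (induction n arbitrary: t u) fastforce+

text \<open>
  The two steps have disjoint images: the first produces vectors with \<open>2 * u < t\<close>, the second
  vectors with \<open>t \<le> 2 * u\<close>.
\<close>

lemma card_fan_vectors: "card (fan_vectors n) = 2 ^ n"
proof (induction n)
  case (Suc n)
  have fin: "finite (fan_vectors n)" by (induction n) auto
  have "pass_step ` fan_vectors n \<inter> keep_step ` fan_vectors n = {}"
    by (auto dest!: fan_vectors_bounds)
  moreover have "inj_on pass_step (fan_vectors n)" "inj_on keep_step (fan_vectors n)"
    by (auto simp: inj_on_def)
  ultimately show ?case using fin Suc by (simp add: card_Un_disjoint card_image)
qed simp

section \<open>Finiteness of the set of feasible vectors\<close>

lemma tau_le:
  assumes "finite (edges G)"
  shows "tau G \<le> 2 ^ card (edges G)"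
proof -
  have "spanning_trees G \<subseteq> Pow (edges G)" by (auto simp: spanning_trees_def)
  then show ?thesis unfolding tau_def using assms by (metis card_Pow card_mono finite_Pow_iff)
qed

text \<open>Since \<open>card\<close> of an infinite set is 0, the final bound rests on this.
  Distinct edges of a simple graph have distinct sets of ends, so there are at most
  \<open>2 ^ N\<close> edges, and each coordinate counts subsets of them.\<close>

lemma finite_planar_feasible: "finite {v. planar_feasible N v}"
proof -
  define M where "M = (2 :: nat) ^ 2 ^ N"
  have "v \<in> {0..int M} \<times> {0..int M}" if feasible: "planar_feasible N v" for v
  proof -
    obtain G :: "(nat, nat) multigraph" and e where
      G: "finite_multigraph G" "simple_multigraph G" "card (verts G) \<le> N"
      and v: "v = (int (tau (contract_edge G e)), int (tau (delete_edge G e)))"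
      using feasible by (auto simp: planar_feasible_def)
    have fin: "finite (verts G)" "finite (edges G)" and sub: "ends G ` edges G \<subseteq> Pow (verts G)"
      using G(1) by (auto simp: finite_multigraph_def)
    have "card (edges G) \<le> card (Pow (verts G))"
      using card_inj_on_le[OF _ sub] G(2) fin by (auto simp: simple_multigraph_def)
    also have "\<dots> \<le> 2 ^ N" using G(3) fin by (simp add: card_Pow)
    finally have E: "card (edges G - {e}) \<le> 2 ^ N"
      using card_mono[of "edges G" "edges G - {e}"] fin by auto
    then have "2 ^ card (edges G - {e}) \<le> M" by (simp add: M_def)
    moreover have "edges (contract_edge G e) = edges G - {e}" "edges (delete_edge G e) = edges G - {e}"
      by (simp_all add: contract_edge_def delete_edge_def)
    ultimately have "tau (contract_edge G e) \<le> M" "tau (delete_edge G e) \<le> M"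
      using tau_le[of "contract_edge G e"] tau_le[of "delete_edge G e"] fin by auto
    then show ?thesis by (simp add: v)
  qed
  then have "{v. planar_feasible N v} \<subseteq> {0..int M} \<times> {0..int M}" by blast
  then show ?thesis by (rule finite_subset) simp
qed

theorem theorem2p5:
  fixes n :: nat
  shows "2 ^ n \<le> card {v. planar_feasible (n + 2) v}"
proof -
  have "fan_vectors n \<subseteq> {v. planar_feasible (n + 2) v}"
    using fan_vectors_realised planar_feasible_fan by blast
  from card_mono[OF finite_planar_feasible this] show ?thesis
    by (simp only: card_fan_vectors)
qed

end
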